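(* For every orthomodular lattice $\mathfrak{A}=\langle A;\cdot,-,0\rangle$ there exists an isomorphism of orthomodular lattices $\mathfrak{A}\to\mathscr{A}_0(\mathscr{S}_0(\mathfrak{A}))$.
   Context: An ortholattice is an algebra $\langle A;\cdot,-,0\rangle$ such that $\langle A;\cdot,0\rangle$ is a meet-semilattice with least element $0$ and $-$ satisfies $a\cdot -a=0$, $a\le b\Rightarrow -b\le -a$, $a=--a$; joins are $a+b:=-(-a\cdot -b)$. An orthomodular lattice is an ortholattice satisfying $a\le b\Rightarrow b=a+(-a\cdot b)$. Isomorphisms are bijections preserving $\cdot$, $-$, $0$. A filter of $\mathfrak{A}$ is a nonempty upward-closed subset closed under binary meets (the improper filter $\omega:=A$ is allowed). $\mathfrak{F}(\mathfrak{A})$ is the set of all filters, $\mathfrak{P}(\mathfrak{A})$ the set of principal filters. $x\perp_A y$ iff there is $a\in A$ with $a\in x$ and $-a\in y$. With $h(a)=\{x\in\mathfrak{F}(\mathfrak{A}):a\in x\}$, $\mathscr{S}_0(\mathfrak{A})=\langle\mathfrak{F}(\mathfrak{A});\subseteq,\perp_A,\mathfrak{P}(\mathfrak{A}),\mathcal{T}\rangle$ where $\mathcal{T}$ is generated by the subbasis $\{h(a):a\in A\}\cup\{\mathfrak{F}(\mathfrak{A})\setminus h(a):a\in A\}$. For a structure $\mathcal{X}=\langle X;\preceq,\perp,\Omega,\mathcal{T}_X\rangle$ with top element $\omega$ of $\langle X;\preceq\rangle$: for $U\subseteq X$, $U^{\perp}:=\{x: x\perp y\text{ for all }y\in U\}$;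 $U$ is $\perp$-stable if $U=U^{\perp\perp}$; $\mathcal{CO}(\mathcal{X})^{\dagger}$ is the set of clopen $\perp$-stable subsets; and $\mathscr{A}_0(\mathcal{X})=\langle\mathcal{CO}(\mathcal{X})^{\dagger};\cap,{}^{\perp},\{\omega\}\rangle$. Thus $\mathscr{A}_0(\mathscr{S}_0(\mathfrak{A}))$ is the algebra of clopen $\perp_A$-stable subsets of $\mathfrak{F}(\mathfrak{A})$ with intersection, ${}^{\perp}$ (w.r.t. $\perp_A$), and constant $\{A\}$. *)

theory Defs
  imports "HOL-Analysis.Analysis" "HOL-Algebra.Congruence"
begin

text \<open>The algebras carry explicit carrier sets (rather than being types of a class), since the
  algebra of clopen stable sets has a proper subset of \<open>'x set\<close> as its universe.\<close>

record 'a ortho_algebra = "'a partial_object" +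
  meet :: "'a \<Rightarrow> 'a \<Rightarrow> 'a" (infixl "\<cdot>\<index>" 70)
  ocmp :: "'a \<Rightarrow> 'a" ("\<sim>\<index> _" [81] 80)
  obot :: 'a ("\<zero>\<index>")

definition leq :: "('a, 'm) ortho_algebra_scheme \<Rightarrow> 'a \<Rightarrow> 'a \<Rightarrow> bool" (infix "\<sqsubseteq>\<index>" 50) where
  "a \<sqsubseteq>\<^bsub>L\<^esub> b \<longleftrightarrow> a \<cdot>\<^bsub>L\<^esub> b = a"

definition ojoin :: "('a, 'm) ortho_algebra_scheme \<Rightarrow> 'a \<Rightarrow> 'a \<Rightarrow> 'a" (infixl "\<squnion>\<index>" 65) where
  "a \<squnion>\<^bsub>L\<^esub> b = \<sim>\<^bsub>L\<^esub> (\<sim>\<^bsub>L\<^esub> a \<cdot>\<^bsub>L\<^esub> \<sim>\<^bsub>L\<^esub> b)"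

locale ortholattice =
  fixes L :: "('a, 'm) ortho_algebra_scheme" (structure)
  assumes meet_closed: "\<lbrakk>a \<in> carrier L; b \<in> carrier L\<rbrakk> \<Longrightarrow> a \<cdot> b \<in> carrier L"
    and ocmp_closed: "a \<in> carrier L \<Longrightarrow> \<sim> a \<in> carrier L"
    and obot_closed: "\<zero> \<in> carrier L"
    and meet_assoc: "\<lbrakk>a \<in> carrier L; b \<in> carrier L; c \<in> carrier L\<rbrakk> \<Longrightarrow> (a \<cdot> b) \<cdot> c = a \<cdot> (b \<cdot> c)"
    and meet_comm: "\<lbrakk>a \<in> carrier L; b \<in> carrier L\<rbrakk> \<Longrightarrow> a \<cdot> b = b \<cdot> a"
    and meet_idem: "a \<in> carrier L \<Longrightarrow> a \<cdot> a = a"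
    and obot_least: "a \<in> carrier L \<Longrightarrow> \<zero> \<sqsubseteq> a"
    and meet_ocmp: "a \<in> carrier L \<Longrightarrow> a \<cdot> \<sim> a = \<zero>"
    and ocmp_antimono: "\<lbrakk>a \<in> carrier L; b \<in> carrier L; a \<sqsubseteq> b\<rbrakk> \<Longrightarrow> \<sim> b \<sqsubseteq> \<sim> a"
    and ocmp_ocmp: "a \<in> carrier L \<Longrightarrow> a = \<sim> (\<sim> a)"

locale orthomodular_lattice = ortholattice +
  assumes orthomodular: "\<lbrakk>a \<in> carrier L; b \<in> carrier L; a \<sqsubseteq> b\<rbrakk> \<Longrightarrow> b = a \<squnion> (\<sim> a \<cdot> b)"

definition ortho_iso ::
    "('a, 'm) ortho_algebra_scheme \<Rightarrow> ('b, 'n) ortho_algebra_scheme \<Rightarrow> ('a \<Rightarrow> 'b) set" where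
  "ortho_iso L M = {f. bij_betw f (carrier L) (carrier M) \<and>
     (\<forall>a\<in>carrier L. \<forall>b\<in>carrier L. f (a \<cdot>\<^bsub>L\<^esub> b) = f a \<cdot>\<^bsub>M\<^esub> f b) \<and>
     (\<forall>a\<in>carrier L. f (\<sim>\<^bsub>L\<^esub> a) = \<sim>\<^bsub>M\<^esub> f a) \<and>
     f \<zero>\<^bsub>L\<^esub> = \<zero>\<^bsub>M\<^esub>}"

text \<open>The whole carrier is allowed as a filter.\<close>

definition filters :: "('a, 'm) ortho_algebra_scheme \<Rightarrow> 'a set set" where
  "filters L = {x. x \<subseteq> carrier L \<and> x \<noteq> {} \<and>
     (\<forall>a\<in>x. \<forall>b\<in>carrier L. a \<sqsubseteq>\<^bsub>L\<^esub> b \<longrightarrow> b \<in> x) \<and>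
     (\<forall>a\<in>x. \<forall>b\<in>x. a \<cdot>\<^bsub>L\<^esub> b \<in> x)}"

definition principal_filters :: "('a, 'm) ortho_algebra_scheme \<Rightarrow> 'a set set" where
  "principal_filters L = {{b \<in> carrier L. a \<sqsubseteq>\<^bsub>L\<^esub> b} | a. a \<in> carrier L}"

definition filter_perp :: "('a, 'm) ortho_algebra_scheme \<Rightarrow> 'a set \<Rightarrow> 'a set \<Rightarrow> bool" where
  "filter_perp L x y \<longleftrightarrow> (\<exists>a\<in>carrier L. a \<in> x \<and> \<sim>\<^bsub>L\<^esub> a \<in> y)"

definition basic_clopen :: "('a, 'm) ortho_algebra_scheme \<Rightarrow> 'a \<Rightarrow> 'a set set" where
  "basic_clopen L a = {x \<in> filters L. a \<in> x}"

definition filter_topology :: "('a, 'm) ortho_algebra_scheme \<Rightarrow> 'a set topology" where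
  "filter_topology L = topology_generated_by
     (basic_clopen L ` carrier L \<union> (\<lambda>a. filters L - basic_clopen L a) ` carrier L)"

text \<open>Structures \<open>\<langle>X; \<preceq>, \<perp>, \<Omega>, \<T>\<rangle>\<close>; the relations are only meant to be used on \<open>X\<close>.\<close>

record 'x ortho_space =
  points :: "'x set"
  sp_le :: "'x \<Rightarrow> 'x \<Rightarrow> bool"
  sp_perp :: "'x \<Rightarrow> 'x \<Rightarrow> bool"
  sp_Omega :: "'x set"
  sp_top :: "'x topology"

definition top_point :: "'x ortho_space \<Rightarrow> 'x" where
  "top_point X = (THE w. w \<in> points X \<and> (\<forall>x\<in>points X. sp_le X x w))"

definition perp_set :: "'x ortho_space \<Rightarrow> 'x set \<Rightarrow> 'x set" where
  "perp_set X U = {x \<in> points X. \<forall>y\<in>U. sp_perp X x y}"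

definition perp_stable :: "'x ortho_space \<Rightarrow> 'x set \<Rightarrow> bool" where
  "perp_stable X U \<longleftrightarrow> U = perp_set X (perp_set X U)"

definition clopen_stable :: "'x ortho_space \<Rightarrow> 'x set set" where
  "clopen_stable X = {U. U \<subseteq> points X \<and> openin (sp_top X) U \<and> closedin (sp_top X) U \<and> perp_stable X U}"

definition S0 :: "('a, 'm) ortho_algebra_scheme \<Rightarrow> 'a set ortho_space" where
  "S0 L = \<lparr>points = filters L, sp_le = (\<subseteq>), sp_perp = filter_perp L,
     sp_Omega = principal_filters L, sp_top = filter_topology L\<rparr>"

definition A0 :: "'x ortho_space \<Rightarrow> 'x set ortho_algebra" where
  "A0 X = \<lparr>carrier = clopen_stable X, meet = (\<inter>), ocmp = perp_set X, obot = {top_point X}\<rparr>"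

end

theory Submission
  imports Defs
begin

text \<open>For the map \<open>h(a) = {x. a \<in> x}\<close>, principal filters give \<open>h(a)\<^sup>\<bottom> = h(-a)\<close> and injectivity.
  For surjectivity let \<open>U\<close> be clopen and stable, so \<open>U\<close> is the intersection of the sets
  \<open>{y}\<^sup>\<bottom>\<close> with \<open>y \<in> U\<^sup>\<bottom>\<close>. Each \<open>{y}\<^sup>\<bottom>\<close> is the directed union of the \<open>h(a)\<close> with
  \<open>-a \<in> y\<close>, so compactness of \<open>U\<close> puts some such \<open>h(a)\<close> between \<open>U\<close> and \<open>{y}\<^sup>\<bottom>\<close>. Thus \<open>U\<close> is
  an intersection of sets \<open>h(a)\<close>; compactness of its complement makes the intersection finite, and
  \<open>U = h(a)\<close> for the meet \<open>a\<close>. Compactness of the space itself comes from Alexander's subbase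
  lemma. Orthomodularity is finally transported along the isomorphism.\<close>

section \<open>Subbases, and transport of the axioms along an isomorphism\<close>

lemma topology_generated_by_eq_subbase:
  "topology_generated_by \<B> =
   topology (arbitrary union_of (finite intersection_of (\<lambda>x. x \<in> \<B>) relative_to \<Union>\<B>))"
    (is "_ = ?X")
\<comment> \<open>Each side is the coarsest topology in which the members of \<B> are open, whence
  both inclusions. The right-hand form is the one \<open>Alexander_subbase\<close> speaks
  about.\<close>
proof (rule topology_eq[THEN iffD2], intro allI iffI)
  fix S
  assume "openin (topology_generated_by \<B>) S"
  then have "generate_topology_on \<B> S"
    by (simp add: openin_topology_generated_by_iff)
  then show "openin ?X S"
    by (rule generate_topology_on_coarsest[OF istopology_openin, rotated])
      (auto simp: openin_subbase intro!: arbitrary_union_of_inc relative_to_subset_inc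
        finite_intersection_of_inc)
next
  fix S
  assume "openin ?X S"
  then show "openin (topology_generated_by \<B>) S"
    by (rule minimal_topology_subbase[rotated 2])
      (simp_all add: topology_generated_by_Basis flip: topology_generated_by_topspace)
qed

text \<open>\<open>M\<close> is a bare record here. Since \<open>f\<close> is onto, each axiom for
  \<open>M\<close> concerns only elements \<open>f a\<close>, and the operations of \<open>M\<close>
  on these are images of those of \<open>L\<close>.\<close>

lemma ortho_iso_orthomodular:
  assumes "orthomodular_lattice L" and f: "f \<in> ortho_iso L M"
  shows "orthomodular_lattice M"
proof -
  interpret L: orthomodular_lattice L by fact
  have inj: "inj_on f (carrier L)" and M: "carrier M = f ` carrier L"
    and meet: "\<And>a b. \<lbrakk>a \<in> carrier L; b \<in> carrier L\<rbrakk> \<Longrightarrow> f a \<cdot>\<^bsub>M\<^esub> f b = f (a \<cdot>\<^bsub>L\<^esub> b)"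
    and ocmp: "\<And>a. a \<in> carrier L \<Longrightarrow> \<sim>\<^bsub>M\<^esub> f a = f (\<sim>\<^bsub>L\<^esub> a)"
    and bot: "\<zero>\<^bsub>M\<^esub> = f \<zero>\<^bsub>L\<^esub>"
    using f by (auto simp: ortho_iso_def bij_betw_def)
  \<comment> \<open>The order is the equation \<open>a \<cdot> b = a\<close>, so injectivity makes
    \<open>f\<close> reflect it.\<close>
  have leq: "f a \<sqsubseteq>\<^bsub>M\<^esub> f b \<longleftrightarrow> a \<sqsubseteq>\<^bsub>L\<^esub> b" if "a \<in> carrier L" "b \<in> carrier L" for a b
    using that inj by (auto simp: leq_def meet L.meet_closed dest: inj_onD)
  have orth: "f b = f a \<squnion>\<^bsub>M\<^esub> (\<sim>\<^bsub>M\<^esub> f a \<cdot>\<^bsub>M\<^esub> f b)"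
    if "a \<in> carrier L" "b \<in> carrier L" "a \<sqsubseteq>\<^bsub>L\<^esub> b" for a b
    using L.orthomodular[OF that] that
    by (simp add: ojoin_def meet ocmp L.meet_closed L.ocmp_closed)
  show ?thesis
    by unfold_locales
      (auto simp: M leq meet ocmp bot L.meet_closed L.ocmp_closed L.obot_closed L.meet_assoc
        L.meet_idem L.obot_least L.meet_ocmp L.ocmp_antimono
        intro!: orth arg_cong[of _ _ f] L.meet_comm L.ocmp_ocmp)
qed

section \<open>Order and complement in an ortholattice\<close>

context ortholattice
begin

lemma leq_refl: "a \<in> carrier L \<Longrightarrow> a \<sqsubseteq> a"
  by (simp add: leq_def meet_idem)

lemma leq_trans:
  "\<lbrakk>a \<sqsubseteq> b; b \<sqsubseteq> c; a \<in> carrier L; b \<in> carrier L; c \<in> carrier L\<rbrakk> \<Longrightarrow> a \<sqsubseteq> c"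
  unfolding leq_def by (metis meet_assoc)

lemma leq_antisym: "\<lbrakk>a \<sqsubseteq> b; b \<sqsubseteq> a; a \<in> carrier L; b \<in> carrier L\<rbrakk> \<Longrightarrow> a = b"
  unfolding leq_def by (metis meet_comm)

lemma meet_leq1: "\<lbrakk>a \<in> carrier L; b \<in> carrier L\<rbrakk> \<Longrightarrow> a \<cdot> b \<sqsubseteq> a"
  unfolding leq_def by (metis meet_assoc meet_comm meet_idem)

lemma meet_leq2: "\<lbrakk>a \<in> carrier L; b \<in> carrier L\<rbrakk> \<Longrightarrow> a \<cdot> b \<sqsubseteq> b"
  unfolding leq_def by (metis meet_assoc meet_idem)

lemma leq_meetI:
  "\<lbrakk>c \<sqsubseteq> a; c \<sqsubseteq> b; a \<in> carrier L; b \<in> carrier L; c \<in> carrier L\<rbrakk> \<Longrightarrow> c \<sqsubseteq> a \<cdot> b"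
  unfolding leq_def by (metis meet_assoc)

lemma leq_ocmp_swap: "\<lbrakk>a \<sqsubseteq> \<sim> b; a \<in> carrier L; b \<in> carrier L\<rbrakk> \<Longrightarrow> b \<sqsubseteq> \<sim> a"
  using ocmp_antimono[of a "\<sim> b"] ocmp_closed ocmp_ocmp[of b, symmetric] by simp

lemma leq_top: "a \<in> carrier L \<Longrightarrow> a \<sqsubseteq> \<sim> \<zero>"
  using leq_ocmp_swap[of \<zero> a] by (simp add: obot_least ocmp_closed obot_closed)

section \<open>Filters and the map \<open>basic_clopen\<close>\<close>

lemma filterD:
  assumes "x \<in> filters L"
  shows "x \<subseteq> carrier L" "x \<noteq> {}"
    and "\<lbrakk>a \<in> x; a \<sqsubseteq> b; b \<in> carrier L\<rbrakk> \<Longrightarrow> b \<in> x"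
    and "\<lbrakk>a \<in> x; b \<in> x\<rbrakk> \<Longrightarrow> a \<cdot> b \<in> x"
  using assms by (auto simp: filters_def)

lemma top_in_filter: "x \<in> filters L \<Longrightarrow> \<sim> \<zero> \<in> x"
  using filterD[of x] leq_top ocmp_closed obot_closed by blast

lemma carrier_filter: "carrier L \<in> filters L"
  using meet_closed obot_closed by (auto simp: filters_def)

lemma principal_filter: "a \<in> carrier L \<Longrightarrow> {b \<in> carrier L. a \<sqsubseteq> b} \<in> filters L"
  by (auto simp: filters_def meet_closed leq_refl intro: leq_trans leq_meetI)

lemma basic_clopen_meet:
  "\<lbrakk>a \<in> carrier L; b \<in> carrier L\<rbrakk> \<Longrightarrow>
   basic_clopen L (a \<cdot> b) = basic_clopen L a \<inter> basic_clopen L b"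
  by (auto simp: basic_clopen_def filterD(4) intro: filterD(3) meet_leq1 meet_leq2 meet_closed)

lemma basic_clopen_mono:
  "\<lbrakk>a \<sqsubseteq> b; b \<in> carrier L\<rbrakk> \<Longrightarrow> basic_clopen L a \<subseteq> basic_clopen L b"
  by (auto simp: basic_clopen_def intro: filterD(3))

lemma basic_clopen_top: "basic_clopen L (\<sim> \<zero>) = filters L"
  using top_in_filter by (auto simp: basic_clopen_def)

lemma basic_clopen_bot: "basic_clopen L \<zero> = {carrier L}"
proof -
  have "x = carrier L" if "x \<in> filters L" "\<zero> \<in> x" for x
    using filterD[OF that(1)] that(2) obot_least by blast
  then show ?thesis
    using carrier_filter obot_closed unfolding basic_clopen_def by blast
qed

text \<open>The principal filter of \<open>d\<close> lies in \<open>basic_clopen L d\<close>, and it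
  lies in \<open>basic_clopen L c\<close> only if d is below c. So the map determines the order, and
  antisymmetry finishes.\<close>

lemma basic_clopen_inj: "inj_on (basic_clopen L) (carrier L)"
proof (rule inj_onI)
  fix a b assume ab: "a \<in> carrier L" "b \<in> carrier L" "basic_clopen L a = basic_clopen L b"
  have leq: "d \<sqsubseteq> c"
    if "c \<in> carrier L" "d \<in> carrier L" "basic_clopen L c = basic_clopen L d" for c d
  proof -
    have "{e \<in> carrier L. d \<sqsubseteq> e} \<in> basic_clopen L d"
      using that principal_filter leq_refl by (simp add: basic_clopen_def)
    then have "{e \<in> carrier L. d \<sqsubseteq> e} \<in> basic_clopen L c"
      using that by simp
    then show ?thesis
      by (simp add: basic_clopen_def)
  qed
  show "a = b"
    using leq_antisym leq[of a b] leq[of b a] ab by simp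
qed

text \<open>One test point suffices: if x is orthogonal to the principal filter of a, some b in x
  has its complement above a, so b is below \<open>\<sim> a\<close> and \<open>\<sim> a\<close> is
  in x. Conversely \<open>\<sim> a\<close> itself witnesses orthogonality.\<close>

lemma perp_set_basic_clopen:
  assumes a: "a \<in> carrier L"
  shows "perp_set (S0 L) (basic_clopen L a) = basic_clopen L (\<sim> a)"
proof (intro equalityI subsetI)
  fix x assume x: "x \<in> perp_set (S0 L) (basic_clopen L a)"
  then have xf: "x \<in> filters L"
    by (simp add: perp_set_def S0_def)
  have "{b \<in> carrier L. a \<sqsubseteq> b} \<in> basic_clopen L a"
    using a principal_filter leq_refl by (simp add: basic_clopen_def)
  with x obtain b where "b \<in> carrier L" "b \<in> x" "a \<sqsubseteq> \<sim> b"
    by (auto simp: perp_set_def S0_def filter_perp_def)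
  then have "\<sim> a \<in> x"
    using filterD(3)[OF xf] leq_ocmp_swap a ocmp_closed by blast
  with xf show "x \<in> basic_clopen L (\<sim> a)"
    by (simp add: basic_clopen_def)
next
  fix x assume "x \<in> basic_clopen L (\<sim> a)"
  then show "x \<in> perp_set (S0 L) (basic_clopen L a)"
    using a ocmp_closed ocmp_ocmp[OF a, symmetric]
    by (auto simp: basic_clopen_def perp_set_def S0_def filter_perp_def intro!: bexI[of _ "\<sim> a"])
qed

section \<open>The topology and its compactness\<close>

lemma topspace_filter_topology: "topspace (filter_topology L) = filters L"
  using basic_clopen_top ocmp_closed[OF obot_closed]
  unfolding filter_topology_def topology_generated_by_topspace
  by (intro equalityI) (auto simp: basic_clopen_def)

lemma openin_basic_clopen: "a \<in> carrier L \<Longrightarrow> openin (filter_topology L) (basic_clopen L a)"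
  unfolding filter_topology_def by (rule topology_generated_by_Basis) blast

lemma closedin_basic_clopen: "a \<in> carrier L \<Longrightarrow> closedin (filter_topology L) (basic_clopen L a)"
  unfolding closedin_def topspace_filter_topology unfolding filter_topology_def
  by (intro conjI topology_generated_by_Basis) (auto simp: basic_clopen_def)

lemma compact_filter_topology: "compact_space (filter_topology L)"
proof (rule Alexander_subbase)
  let ?B = "basic_clopen L ` carrier L \<union> (\<lambda>a. filters L - basic_clopen L a) ` carrier L"
  show "topology (arbitrary union_of (finite intersection_of (\<lambda>x. x \<in> ?B) relative_to \<Union>?B)) =
      filter_topology L"
    unfolding filter_topology_def topology_generated_by_eq_subbase ..
  fix C assume CB: "C \<subseteq> ?B" and "\<Union>C = topspace (filter_topology L)"
  then have cover: "\<Union>C = filters L"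
    by (simp add: topspace_filter_topology)
  \<comment> \<open>\<open>F\<close> is the filter generated by \<open>Q\<close>, described by what
    finite subsets of \<open>Q\<close> force in all filters, which avoids finite meets and covers
    \<open>S = {}\<close>. As a point of the space, \<open>F\<close> must lie in some member of the
    cover.\<close>
  define Q where "Q = {b \<in> carrier L. filters L - basic_clopen L b \<in> C}"
  define F where
    "F = {c \<in> carrier L. \<exists>S. finite S \<and> S \<subseteq> Q \<and> (\<forall>x\<in>filters L. S \<subseteq> x \<longrightarrow> c \<in> x)}"
  have "F \<in> filters L"
    unfolding filters_def
  proof (intro CollectI conjI ballI impI)
    show "F \<subseteq> carrier L" by (auto simp: F_def)
    have "\<sim> \<zero> \<in> F"
      using top_in_filter ocmp_closed obot_closed by (auto simp: F_def intro!: exI[of _ "{}"])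
    then show "F \<noteq> {}" by blast
  next
    fix a b assume b: "a \<in> F" "b \<in> carrier L" "a \<sqsubseteq> b"
    then obtain S where S: "finite S" "S \<subseteq> Q" "\<forall>x\<in>filters L. S \<subseteq> x \<longrightarrow> a \<in> x"
      by (auto simp: F_def)
    have "b \<in> x" if "x \<in> filters L" "S \<subseteq> x" for x
      using filterD(3)[OF that(1) _ b(3,2)] S(3) that by simp
    with b(2) S show "b \<in> F"
      by (auto simp: F_def)
  next
    fix a b assume "a \<in> F" "b \<in> F"
    then obtain S T where "a \<in> carrier L" "finite S" "S \<subseteq> Q" "\<forall>x\<in>filters L. S \<subseteq> x \<longrightarrow> a \<in> x"
      and "b \<in> carrier L" "finite T" "T \<subseteq> Q" "\<forall>x\<in>filters L. T \<subseteq> x \<longrightarrow> b \<in> x"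
      by (auto simp: F_def)
    then show "a \<cdot> b \<in> F"
      by (auto simp: F_def meet_closed filterD(4) intro!: exI[of _ "S \<union> T"])
  qed
  then obtain U where U: "U \<in> C" "F \<in> U"
    using cover by blast
  \<comment> \<open>So \<open>F\<close> lies in no complement belonging to \<open>C\<close>, and its
    covering set \<open>U\<close> has the form \<open>basic_clopen L a\<close>.\<close>
  have "b \<in> F" if "b \<in> Q" for b
    using that by (auto simp: F_def Q_def intro!: exI[of _ "{b}"])
  then obtain a where a: "a \<in> carrier L" "U = basic_clopen L a"
    using U CB by (auto simp: basic_clopen_def Q_def)
  with U have "a \<in> F"
    by (simp add: basic_clopen_def)
  then obtain S where S: "finite S" "S \<subseteq> Q" "\<And>x. \<lbrakk>x \<in> filters L; S \<subseteq> x\<rbrakk> \<Longrightarrow> a \<in> x"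
    by (auto simp: F_def)
  let ?C = "insert U ((\<lambda>b. filters L - basic_clopen L b) ` S)"
  have sub: "?C \<subseteq> C"
    using S(2) U by (auto simp: Q_def)
  \<comment> \<open>A filter missed by all the chosen complements contains \<open>S\<close>, hence
    contains a, hence lies in \<open>U\<close>.\<close>
  have "filters L \<subseteq> \<Union>?C"
    using S(3) a by (auto simp: basic_clopen_def)
  then have "\<Union>?C = topspace (filter_topology L)"
    unfolding topspace_filter_topology using Union_mono[OF sub] cover by (intro subset_antisym) simp_all
  with sub S(1) show "\<exists>C'. finite C' \<and> C' \<subseteq> C \<and> \<Union>C' = topspace (filter_topology L)"
    by (intro exI[of _ ?C]) simp
qed

section \<open>Clopen stable sets are exactly the sets \<open>basic_clopen L a\<close>\<close>

lemma basic_clopen_in_clopen_stable: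
  assumes "a \<in> carrier L"
  shows "basic_clopen L a \<in> clopen_stable (S0 L)"
proof -
  have "basic_clopen L a \<subseteq> points (S0 L)"
    by (auto simp: S0_def basic_clopen_def)
  moreover have "perp_stable (S0 L) (basic_clopen L a)"
    using assms ocmp_ocmp[OF assms, symmetric] by (simp add: perp_stable_def perp_set_basic_clopen ocmp_closed)
  ultimately show ?thesis
    using openin_basic_clopen[OF assms] closedin_basic_clopen[OF assms]
    by (simp add: clopen_stable_def S0_def)
qed

text \<open>This is the directedness behind the compactness argument: the join of \<open>S\<close>
  serves as a, because its complement is the meet of the complements, which stays in the filter y.
  The empty join is \<open>\<zero>\<close>.\<close>

lemma finite_union_basic_clopen_subset:
  assumes y: "y \<in> filters L" and "finite S" "S \<subseteq> {a \<in> carrier L. \<sim> a \<in> y}"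
  shows "\<exists>a\<in>carrier L. \<sim> a \<in> y \<and> \<Union>(basic_clopen L ` S) \<subseteq> basic_clopen L a"
  using assms(2,3)
proof (induction S rule: finite_induct)
  case empty
  then show ?case
    using top_in_filter[OF y] obot_closed by (auto intro!: bexI[of _ "\<zero>"])
next
  case (insert b S)
  then obtain a where a: "a \<in> carrier L" "\<sim> a \<in> y" "\<Union>(basic_clopen L ` S) \<subseteq> basic_clopen L a"
    by auto
  have b: "b \<in> carrier L" "\<sim> b \<in> y"
    using insert by auto
  have c: "\<sim> a \<cdot> \<sim> b \<in> carrier L"
    using a b by (simp add: meet_closed ocmp_closed)
  have "a \<sqsubseteq> a \<squnion> b" "b \<sqsubseteq> a \<squnion> b"
    unfolding ojoin_def using a b c
    by (simp_all add: leq_ocmp_swap[OF meet_leq1] leq_ocmp_swap[OF meet_leq2] ocmp_closed)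
  moreover have j: "a \<squnion> b \<in> carrier L"
    using c by (simp add: ojoin_def ocmp_closed)
  ultimately have "basic_clopen L a \<subseteq> basic_clopen L (a \<squnion> b)" "basic_clopen L b \<subseteq> basic_clopen L (a \<squnion> b)"
    by (simp_all add: basic_clopen_mono)
  moreover have "\<sim> (a \<squnion> b) \<in> y"
    using filterD(4)[OF y a(2) b(2)] ocmp_ocmp[OF c, symmetric] by (simp add: ojoin_def)
  ultimately show ?case
    using a(3) j by (intro bexI[of _ "a \<squnion> b"]) auto
qed

text \<open>The witness is the meet of \<open>S\<close>. Intersecting with \<open>filters L\<close>
  gives the empty family its value within the space, attained at
  \<open>\<sim> \<zero>\<close>.\<close>

lemma finite_inter_basic_clopen:
  assumes "finite S" "S \<subseteq> carrier L"
  shows "\<exists>a\<in>carrier L. basic_clopen L a = filters L \<inter> \<Inter>(basic_clopen L ` S)"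
  using assms
proof (induction S rule: finite_induct)
  case empty
  then show ?case
    using basic_clopen_top ocmp_closed obot_closed by auto
next
  case (insert b S)
  then obtain a where "a \<in> carrier L" "basic_clopen L a = filters L \<inter> \<Inter>(basic_clopen L ` S)"
    by auto
  with insert show ?case
    by (intro bexI[of _ "b \<cdot> a"]) (auto simp: basic_clopen_meet meet_closed)
qed

lemma clopen_stable_is_basic_clopen:
  assumes U: "U \<in> clopen_stable (S0 L)"
  shows "\<exists>a\<in>carrier L. U = basic_clopen L a"
proof -
  let ?T = "filter_topology L"
  let ?P = "perp_set (S0 L) U"
  have op: "openin ?T U" and cl: "closedin ?T U" and stable: "U = perp_set (S0 L) ?P"
    and sub: "U \<subseteq> filters L"
    using U by (auto simp: clopen_stable_def S0_def perp_stable_def)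
  \<comment> \<open>Both sets are closed in a compact space, the complement because \<open>U\<close>
    is open.\<close>
  have cU: "compactin ?T U" and cV: "compactin ?T (filters L - U)"
    using compact_filter_topology op cl
    by (auto intro!: closedin_compact_space simp: closedin_def topspace_filter_topology double_diff sub)
  define W where "W = {a \<in> carrier L. U \<subseteq> basic_clopen L a}"
  have W: "\<exists>a\<in>W. \<sim> a \<in> y" if "y \<in> ?P" for y
  proof -
    have y: "y \<in> filters L"
      using that by (simp add: perp_set_def S0_def)
    let ?D = "{a \<in> carrier L. \<sim> a \<in> y}"
    \<comment> \<open>Orthogonality of x to y means precisely that some a in x has
      \<open>\<sim> a\<close> in y.\<close>
    have "U \<subseteq> \<Union>(basic_clopen L ` ?D)"
    proof
      fix x assume "x \<in> U"
      then have "x \<in> filters L" "filter_perp L x y"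
        using that stable by (auto simp: perp_set_def S0_def)
      then show "x \<in> \<Union>(basic_clopen L ` ?D)"
        by (auto simp: filter_perp_def basic_clopen_def)
    qed
    then obtain G where G: "finite G" "G \<subseteq> basic_clopen L ` ?D" "U \<subseteq> \<Union>G"
      using compactinD[OF cU, of "basic_clopen L ` ?D"] openin_basic_clopen by auto
    obtain S where S: "S \<subseteq> ?D" "finite S" "G = basic_clopen L ` S"
      using finite_subset_image[OF G(1,2)] by blast
    then obtain a where "a \<in> carrier L" "\<sim> a \<in> y" "\<Union>(basic_clopen L ` S) \<subseteq> basic_clopen L a"
      using finite_union_basic_clopen_subset[OF y] by blast
    with G(3) S(3) show ?thesis
      by (intro bexI[of _ a]) (simp_all add: W_def subset_trans[of U])
  qed
  \<comment> \<open>By stability, a point x outside \<open>U\<close> fails to be orthogonal to some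
    y in \<open>?P\<close>. An a in \<open>W\<close> with \<open>\<sim> a\<close> in y then cannot
    belong to x.\<close>
  have "filters L - U \<subseteq> \<Union>((\<lambda>a. filters L - basic_clopen L a) ` W)"
  proof
    fix x assume x: "x \<in> filters L - U"
    then obtain y where y: "y \<in> ?P" "\<not> filter_perp L x y"
      using stable by (auto simp: perp_set_def S0_def)
    with W obtain a where "a \<in> W" "\<sim> a \<in> y" by blast
    with x y show "x \<in> \<Union>((\<lambda>a. filters L - basic_clopen L a) ` W)"
      by (auto simp: W_def filter_perp_def basic_clopen_def)
  qed
  moreover have "openin ?T (filters L - basic_clopen L a)" if "a \<in> W" for a
    using closedin_basic_clopen that by (auto simp: W_def closedin_def topspace_filter_topology)
  ultimately obtain G where G: "finite G" "G \<subseteq> (\<lambda>a. filters L - basic_clopen L a) ` W"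
    "filters L - U \<subseteq> \<Union>G"
    using compactinD[OF cV, of "(\<lambda>a. filters L - basic_clopen L a) ` W"] by auto
  obtain S where S: "S \<subseteq> W" "finite S" "G = (\<lambda>a. filters L - basic_clopen L a) ` S"
    using finite_subset_image[OF G(1,2)] by blast
  moreover have "S \<subseteq> carrier L"
    using S by (auto simp: W_def)
  ultimately obtain a where "a \<in> carrier L" "basic_clopen L a = filters L \<inter> \<Inter>(basic_clopen L ` S)"
    using finite_inter_basic_clopen by blast
  \<comment> \<open>One inclusion is the definition of \<open>W\<close>; the other is the finite
    cover of the complement, read contrapositively.\<close>
  moreover have "U = filters L \<inter> \<Inter>(basic_clopen L ` S)"
    using S G(3) sub by (auto simp: W_def)
  ultimately show ?thesis by auto
qed

lemma top_point_S0: "top_point (S0 L) = carrier L"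
  unfolding top_point_def S0_def
  by (rule the_equality) (use carrier_filter filterD(1) in \<open>auto dest: filterD(1)\<close>)

lemma basic_clopen_ortho_iso: "basic_clopen L \<in> ortho_iso L (A0 (S0 L))"
proof -
  have "basic_clopen L ` carrier L = clopen_stable (S0 L)"
    using basic_clopen_in_clopen_stable clopen_stable_is_basic_clopen by blast
  then show ?thesis
    using basic_clopen_inj
    by (simp add: ortho_iso_def A0_def bij_betw_def basic_clopen_meet perp_set_basic_clopen
        basic_clopen_bot top_point_S0)
qed

end

theorem theorem3p9:
  fixes A :: "('a, 'm) ortho_algebra_scheme"
  assumes "orthomodular_lattice A"
  shows "orthomodular_lattice (A0 (S0 A)) \<and> (\<exists>f. f \<in> ortho_iso A (A0 (S0 A)))"
proof -
  interpret orthomodular_lattice A by fact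
  show ?thesis
    using basic_clopen_ortho_iso ortho_iso_orthomodular[OF assms] by blast
qed

end
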